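(* Let $q$ be a prime power, let $H$ be a normalized generalized Hadamard matrix $\mathrm{GH}(q,v/q)$ over $\mathbb{F}_q$, and let $(C,\star)$, with $C=C_H$, be a generalized Hadamard full propelinear code (GHFP-code) of length $v$ over $\mathbb{F}_q$ coming from $H$. Let $D_1$ be the set of $x\in C_H$ whose first coordinate is $0$. Then $F_H=D_1$ is a central relative $(v,q,v,v/q)$-difference set in the group $(C,\star)$ relative to the normal subgroup $C_1=\{\alpha\mathbf 1:\alpha\in\mathbb{F}_q\}\cong\mathbb{F}_q$.
   Context: Generalized Hadamard codes. A $v\times v$ matrix $H=(h_{ij})$ over the additive group $\mathbb{F}_q$, $q\mid v$, is a $\mathrm{GH}(q,v/q)$ if for all $i<j$ the multiset $\{h_{ik}-h_{jk}:1\le k\le v\}$ contains each element of $\mathbb{F}_q$ exactly $v/q$ times; it is normalized if its first row and column are zero. $F_H\subseteq\mathbb{F}_q^v$ is the set of rows of $H$ and $C_H=\bigcup_{\alpha\in\mathbb{F}_q}(F_H+\alpha\mathbf 1)$, with $\mathbf 1$ the all-one vector, is called a generalized Hadamard code. Full propelinear codes. For $\pi\in\mathcal{S}_n$ and $y\in\mathbb{F}_q^n$, $\pi(y)=(y_{\pi^{-1}(1)},\dots,y_{\pi^{-1}(n)})$. A code $C\subseteq\mathbb{F}_q^n$ with $\mathbf 0\in C$ is full propelinear if to every $x\in C$ is assigned $\pi_x\in\mathcal{S}_n$ such that, writing $x\star y=x+\pi_x(y)$: (i) $x\star C=C$ for all $x\in C$; (ii) $\pi_{x\star y}=\pi_x\circ\pi_y$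 for all $x,y\in C$; (iii) $\pi_x$ fixes no coordinate if $x\notin\{\alpha\mathbf 1:\alpha\in\mathbb{F}_q\}$, and $\pi_x=\mathrm{Id}$ if $x=\alpha\mathbf 1$ for some $\alpha\in\mathbb{F}_q$. Then $(C,\star)$ is a group with identity $\mathbf 0$. A GHFP-code is a generalized Hadamard code that is full propelinear. Relative difference sets. Let $E$ be a group of order $vw$ with a normal subgroup $Z$ of order $w$. A $k$-subset $R$ of $E$ is a relative $(v,w,k,\lambda)$-difference set in $E$ relative to (with forbidden subgroup) $Z$ if the multiset of quotients $r_1r_2^{-1}$ with $r_1,r_2\in R$, $r_1\neq r_2$, contains each element of $E\setminus Z$ exactly $\lambda$ times and no element of $Z$. It is called central if $Z$ is a central subgroup of $E$. *)

theory Defs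
  imports
    "Jordan_Normal_Form.Matrix"
    "HOL-Algebra.Coset"
    "HOL-Library.Multiset"
    "HOL-Library.Cardinality"
    "HOL-Combinatorics.Permutations"
begin

text \<open>
  The finite field with $q$ elements is a type \<open>'a\<close> of sort \<open>{finite, field}\<close> with \<open>q = CARD('a)\<close>.
  Coordinates of vectors, and rows and columns of matrices, are numbered from \<open>0\<close>, so that the
  first coordinate has index \<open>0\<close>.
\<close>

definition generalized_hadamard :: "nat \<Rightarrow> 'a::{finite,field} mat \<Rightarrow> bool" where
  "generalized_hadamard v H \<longleftrightarrow>
     v > 0 \<and> CARD('a) dvd v \<and> H \<in> carrier_mat v v \<and>
     (\<forall>i j. i < j \<and> j < v \<longrightarrow>
        (\<forall>a. count (image_mset (\<lambda>k. H $$ (i, k) - H $$ (j, k)) (mset_set {..<v})) a = v div CARD('a)))"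

definition normalized_mat :: "'a::zero mat \<Rightarrow> bool" where
  "normalized_mat H \<longleftrightarrow>
     (\<forall>k < dim_col H. H $$ (0, k) = 0) \<and> (\<forall>k < dim_row H. H $$ (k, 0) = 0)"

definition const_vec :: "nat \<Rightarrow> 'a \<Rightarrow> 'a vec" where
  "const_vec n a = vec n (\<lambda>_. a)"

definition row_set :: "'a mat \<Rightarrow> 'a vec set" where
  "row_set H = set (rows H)"

definition gh_code :: "'a::plus mat \<Rightarrow> 'a vec set" where
  "gh_code H = (\<Union>a. (\<lambda>x. x + const_vec (dim_col H) a) ` row_set H)"

text \<open>\<open>inv_into UNIV\<close> is the inverse function; its short form clashes with the group inverse
  of HOL-Algebra.\<close>

definition permute_coords :: "(nat \<Rightarrow> nat) \<Rightarrow> 'a vec \<Rightarrow> 'a vec" where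
  "permute_coords p y = vec (dim_vec y) (\<lambda>i. y $ (inv_into UNIV p i))"

definition propelinear_mult ::
  "('a::plus vec \<Rightarrow> nat \<Rightarrow> nat) \<Rightarrow> 'a vec \<Rightarrow> 'a vec \<Rightarrow> 'a vec" where
  "propelinear_mult \<pi> x y = x + permute_coords (\<pi> x) y"

text \<open>Only the values of \<open>\<pi>\<close> on \<open>C\<close> matter.\<close>

definition full_propelinear ::
  "nat \<Rightarrow> 'a::{finite,field} vec set \<Rightarrow> ('a vec \<Rightarrow> nat \<Rightarrow> nat) \<Rightarrow> bool" where
  "full_propelinear n C \<pi> \<longleftrightarrow>
     C \<subseteq> carrier_vec n \<and> 0\<^sub>v n \<in> C \<and>
     (\<forall>x\<in>C. \<pi> x permutes {..<n}) \<and>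
     (\<forall>x\<in>C. propelinear_mult \<pi> x ` C = C) \<and>
     (\<forall>x\<in>C. \<forall>y\<in>C. \<pi> (propelinear_mult \<pi> x y) = \<pi> x \<circ> \<pi> y) \<and>
     (\<forall>x\<in>C. (x \<notin> range (const_vec n) \<longrightarrow> (\<forall>i<n. \<pi> x i \<noteq> i)) \<and>
             (x \<in> range (const_vec n) \<longrightarrow> \<pi> x = id))"

definition ghfp_code ::
  "nat \<Rightarrow> 'a::{finite,field} mat \<Rightarrow> ('a vec \<Rightarrow> nat \<Rightarrow> nat) \<Rightarrow> bool" where
  "ghfp_code v H \<pi> \<longleftrightarrow> generalized_hadamard v H \<and> full_propelinear v (gh_code H) \<pi>"

definition propelinear_group ::
  "nat \<Rightarrow> 'a::{plus,zero} vec set \<Rightarrow> ('a vec \<Rightarrow> nat \<Rightarrow> nat) \<Rightarrow> 'a vec monoid" where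
  "propelinear_group n C \<pi> = \<lparr>carrier = C, monoid.mult = propelinear_mult \<pi>, one = 0\<^sub>v n\<rparr>"

definition additive_group :: "'a::{plus,zero} monoid" where
  "additive_group = \<lparr>carrier = UNIV, monoid.mult = (+), one = 0\<rparr>"

definition relative_difference_set ::
  "('g, 'm) monoid_scheme \<Rightarrow> 'g set \<Rightarrow> 'g set \<Rightarrow> nat \<Rightarrow> nat \<Rightarrow> nat \<Rightarrow> nat \<Rightarrow> bool" where
  "relative_difference_set E Z R v w k l \<longleftrightarrow>
     group E \<and> finite (carrier E) \<and> order E = v * w \<and>
     Z \<lhd> E \<and> card Z = w \<and>
     R \<subseteq> carrier E \<and> card R = k \<and>
     (let Q = image_mset (\<lambda>(r1, r2). r1 \<otimes>\<^bsub>E\<^esub> inv\<^bsub>E\<^esub> r2)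
                (mset_set {(r1, r2). r1 \<in> R \<and> r2 \<in> R \<and> r1 \<noteq> r2})
      in (\<forall>e \<in> carrier E - Z. count Q e = l) \<and> (\<forall>z \<in> Z. z \<notin># Q))"

definition central_relative_difference_set ::
  "('g, 'm) monoid_scheme \<Rightarrow> 'g set \<Rightarrow> 'g set \<Rightarrow> nat \<Rightarrow> nat \<Rightarrow> nat \<Rightarrow> nat \<Rightarrow> bool" where
  "central_relative_difference_set E Z R v w k l \<longleftrightarrow>
     relative_difference_set E Z R v w k l \<and>
     (\<forall>z\<in>Z. \<forall>x\<in>carrier E. z \<otimes>\<^bsub>E\<^esub> x = x \<otimes>\<^bsub>E\<^esub> z)"

end

theory Submission
  imports Defs
begin

text \<open>
  An element \<open>e\<close> of the group is a quotient \<open>r\<^sub>1 r\<^sub>2\<inverse>\<close> of rows of \<open>H\<close> exactly when \<open>e \<star> r\<^sub>2\<close> is again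
  a row, that is, when its first coordinate \<open>e\<^sub>0 + (r\<^sub>2)\<^sub>k\<close> vanishes, where \<open>k\<close> is the preimage of the
  first coordinate under \<open>\<pi>\<^sub>e\<close>. For \<open>e\<close> outside the constants \<open>k\<close> is not the first coordinate, so the
  claim is that every other column of \<open>H\<close> is balanced. This is the fact that the transpose of
  a generalized Hadamard matrix over an abelian group is again one, and it follows from a second
  moment computation: \<open>h\<^sub>i\<^sub>k - h\<^sub>i\<^sub>l = h\<^sub>j\<^sub>k - h\<^sub>j\<^sub>l\<close> if and only if \<open>h\<^sub>i\<^sub>k - h\<^sub>j\<^sub>k = h\<^sub>i\<^sub>l - h\<^sub>j\<^sub>l\<close>, so the total
  squared deviations from uniformity, over pairs of rows and over pairs of columns, agree.
\<close>

section \<open>Deviation from uniformity, and the passage from rows to columns\<close>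

definition deviation :: "'b set \<Rightarrow> ('b \<Rightarrow> 'a::finite) \<Rightarrow> real" where
  "deviation A f = (\<Sum>d\<in>UNIV. (real (card {x\<in>A. f x = d}) - real (card A) / real CARD('a))\<^sup>2)"

lemma deviation_nonneg: "deviation A f \<ge> 0"
  unfolding deviation_def by (intro sum_nonneg) simp

lemma deviation_eq_0_iff:
  fixes f :: "'b \<Rightarrow> 'a::finite"
  shows "deviation A f = 0 \<longleftrightarrow> (\<forall>d. real (card {x\<in>A. f x = d}) = real (card A) / real CARD('a))"
  unfolding deviation_def by (subst sum_nonneg_eq_0_iff) auto

text \<open>Expanding the square, the counts add up to \<open>card A\<close>, so the linear and
  constant terms combine to the subtracted fraction, while the squared counts count pairs with equal
  values. Only coincidences \<open>f x = f y\<close> remain, which makes rows and columns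
  comparable.\<close>

lemma deviation_eq:
  fixes f :: "'b \<Rightarrow> 'a::finite"
  assumes A: "finite A"
  shows "deviation A f =
    (\<Sum>x\<in>A. \<Sum>y\<in>A. of_bool (f x = f y)) - (real (card A))\<^sup>2 / real CARD('a)"
proof -
  define m where "m d = real (card {x\<in>A. f x = d})" for d
  define c where "c = real (card A) / real CARD('a)"
  have m: "m d = (\<Sum>x\<in>A. of_bool (f x = d))" for d
    using A by (simp add: m_def Int_def flip: sum.inter_filter)
  have tot: "(\<Sum>d\<in>UNIV. m d) = real (card A)"
    unfolding m by (subst sum.swap) simp
  have "(\<Sum>d\<in>UNIV. (m d)\<^sup>2) =
      (\<Sum>d\<in>UNIV. \<Sum>x\<in>A. \<Sum>y\<in>A. of_bool (f x = d) * of_bool (f y = d))"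
    by (simp only: m power2_eq_square sum_product)
  also have "\<dots> = (\<Sum>x\<in>A. \<Sum>y\<in>A. \<Sum>d\<in>UNIV. of_bool (f x = d) * of_bool (f y = d))"
    by (subst sum.swap, rule sum.cong[OF refl], rule sum.swap)
  \<comment> \<open>For fixed \<open>x\<close> and \<open>y\<close> only \<open>d = f x\<close> can
    contribute, and it does so exactly if \<open>f y\<close> has the same value.\<close>
  also have "\<dots> = (\<Sum>x\<in>A. \<Sum>y\<in>A. of_bool (f x = f y))"
    by (intro sum.cong refl) (auto simp: of_bool_def if_distrib[of "\<lambda>t. t * _"] cong: if_cong)
  finally have sq: "(\<Sum>d\<in>UNIV. (m d)\<^sup>2) = (\<Sum>x\<in>A. \<Sum>y\<in>A. of_bool (f x = f y))" .
  have "deviation A f = (\<Sum>d\<in>UNIV. (m d)\<^sup>2 - 2 * c * m d + c\<^sup>2)"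
    unfolding deviation_def m_def c_def by (simp add: power2_diff algebra_simps)
  also have "\<dots> = (\<Sum>d\<in>UNIV. (m d)\<^sup>2) - 2 * c * real (card A) + real CARD('a) * c\<^sup>2"
    by (simp add: sum.distrib sum_subtractf tot flip: sum_distrib_left)
  also have "\<dots> = (\<Sum>d\<in>UNIV. (m d)\<^sup>2) - (real (card A))\<^sup>2 / real CARD('a)"
    by (simp add: c_def power2_eq_square field_simps)
  finally show ?thesis by (simp add: sq)
qed

text \<open>Rows and columns share the index set \<open>A\<close>, so both totals subtract the same
  constant for each pair. Row deviations vanish off the diagonal and the diagonals coincide; hence
  the off-diagonal column deviations, all nonnegative, sum to zero.\<close>

lemma row_balance_imp_column_balance:
  fixes h :: "'b \<Rightarrow> 'b \<Rightarrow> 'a::{finite,ab_group_add}"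
  assumes A: "finite A"
    and rows: "\<And>i j d. i \<in> A \<Longrightarrow> j \<in> A \<Longrightarrow> i \<noteq> j \<Longrightarrow>
      real (card {k\<in>A. h i k - h j k = d}) = real (card A) / real CARD('a)"
    and k: "k \<in> A" and l: "l \<in> A" and kl: "k \<noteq> l"
  shows "real (card {i\<in>A. h i k - h i l = d}) = real (card A) / real CARD('a)"
proof -
  define R where "R i j = deviation A (\<lambda>k. h i k - h j k)" for i j
  define S where "S k l = deviation A (\<lambda>i. h i k - h i l)" for k l
  have "(\<Sum>i\<in>A. \<Sum>j\<in>A. \<Sum>k\<in>A. \<Sum>l\<in>A. of_bool (h i k - h j k = h i l - h j l) :: real) =
        (\<Sum>k\<in>A. \<Sum>l\<in>A. \<Sum>i\<in>A. \<Sum>j\<in>A. of_bool (h i k - h j k = h i l - h j l))"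
    unfolding sum.cartesian_product
    by (rule sum.reindex_bij_witness[of _ "\<lambda>(k, l, i, j). (i, j, k, l)" "\<lambda>(i, j, k, l). (k, l, i, j)"])
       auto
  \<comment> \<open>Moving \<open>h j k\<close> and \<open>h i l\<close> across the equation uses
    that the group is abelian.\<close>
  also have "\<dots> = (\<Sum>k\<in>A. \<Sum>l\<in>A. \<Sum>i\<in>A. \<Sum>j\<in>A. of_bool (h i k - h i l = h j k - h j l))"
    by (intro sum.cong refl arg_cong[where f = of_bool]) (auto simp: algebra_simps)
  finally have total: "(\<Sum>i\<in>A. \<Sum>j\<in>A. R i j) = (\<Sum>k\<in>A. \<Sum>l\<in>A. S k l)"
    by (simp add: R_def S_def deviation_eq[OF A] sum_subtractf)
  have split: "(\<Sum>i\<in>A. \<Sum>j\<in>A. F i j) = (\<Sum>i\<in>A. F i i) + (\<Sum>i\<in>A. \<Sum>j\<in>A - {i}. F i j)"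
    for F :: "'b \<Rightarrow> 'b \<Rightarrow> real"
    by (simp add: sum.remove[OF A] flip: sum.distrib)
  have "R i j = 0" if "i \<in> A" "j \<in> A - {i}" for i j
    using that rows unfolding R_def deviation_eq_0_iff by auto
  \<comment> \<open>Both difference functions are constantly zero here. The common deviation is not
    zero in general, but it cancels from the two totals.\<close>
  moreover have "R i i = S i i" for i
    by (simp add: R_def S_def)
  ultimately have "(\<Sum>k\<in>A. \<Sum>l\<in>A - {k}. S k l) = 0"
    using total by (simp add: split)
  then have "S k l = 0"
    using A k l kl
    by (auto simp: sum_nonneg_eq_0_iff S_def deviation_nonneg sum_nonneg)
  then show ?thesis
    unfolding S_def deviation_eq_0_iff by blast
qed

section \<open>Balance of the rows and columns of a generalized Hadamard matrix\<close>

lemma count_image_mset_set: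
  assumes "finite A"
  shows "count (image_mset f (mset_set A)) a = card {x\<in>A. f x = a}"
  using assms by (simp add: count_image_mset vimage_def Int_def conj_commute)

text \<open>The definition covers \<open>i < j\<close> only; exchanging the two rows negates every
  difference, and negation permutes the values \<open>a\<close>.\<close>

lemma generalized_hadamard_rows:
  fixes H :: "'a::{finite,field} mat"
  assumes H: "generalized_hadamard v H" and ij: "i < v" "j < v" "i \<noteq> j"
  shows "card {k\<in>{..<v}. H $$ (i, k) - H $$ (j, k) = a} = v div CARD('a)"
proof -
  have *: "card {k\<in>{..<v}. H $$ (i, k) - H $$ (j, k) = a} = v div CARD('a)"
    if "i < j" "j < v" for i j a
    using H that unfolding generalized_hadamard_def by (auto simp: count_image_mset_set)
  show ?thesis
  proof (cases "i < j")
    case True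
    then show ?thesis using * ij by blast
  next
    case False
    have "{k\<in>{..<v}. H $$ (i, k) - H $$ (j, k) = a} =
        {k\<in>{..<v}. H $$ (j, k) - H $$ (i, k) = - a}"
      by (auto simp: algebra_simps)
    then show ?thesis using * ij False by simp
  qed
qed

lemma generalized_hadamard_columns:
  fixes H :: "'a::{finite,field} mat"
  assumes H: "generalized_hadamard v H" and "k < v" "l < v" "k \<noteq> l"
  shows "card {i\<in>{..<v}. H $$ (i, k) - H $$ (i, l) = a} = v div CARD('a)"
proof -
  have "CARD('a) dvd v"
    using H by (simp add: generalized_hadamard_def)
  then have div: "real (v div CARD('a)) = real v / real CARD('a)"
    by (rule real_of_nat_div)
  have "real (card {i\<in>{..<v}. H $$ (i, k) - H $$ (i, l) = a}) =
      real (card {..<v}) / real CARD('a)"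
    by (rule row_balance_imp_column_balance)
       (use assms generalized_hadamard_rows[OF H] div in auto)
  then show ?thesis by (simp flip: div)
qed

lemma card_field_ge_2: "CARD('a::{finite,field}) \<ge> 2"
proof -
  have "card {0, 1 :: 'a} \<le> CARD('a)"
    by (intro card_mono) auto
  then show ?thesis by simp
qed

text \<open>Two equal rows would have difference 0 in all \<open>v\<close> places, more than the
  allowed \<open>v div CARD('a)\<close>, since a field has at least two elements.\<close>

lemma generalized_hadamard_inj_on_row:
  fixes H :: "'a::{finite,field} mat"
  assumes H: "generalized_hadamard v H"
  shows "inj_on (row H) {..<v}"
proof (rule inj_onI, rule ccontr)
  fix i j assume ij: "i \<in> {..<v}" "j \<in> {..<v}" "row H i = row H j" "i \<noteq> j"
  have H': "H \<in> carrier_mat v v" "v > 0"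
    using H by (auto simp: generalized_hadamard_def)
  have "H $$ (i, k) = H $$ (j, k)" if "k < v" for k
    using arg_cong[OF ij(3), of "\<lambda>x. x $ k"] ij(1,2) that H' by simp
  then have "{k\<in>{..<v}. H $$ (i, k) - H $$ (j, k) = 0} = {..<v}"
    by auto
  then have "v = v div CARD('a)"
    using generalized_hadamard_rows[OF H, of i j 0] ij by simp
  moreover have "v div CARD('a) < v"
    using card_field_ge_2[where 'a = 'a] H' by (intro div_less_dividend) auto
  ultimately show False by simp
qed

section \<open>Coordinate permutations and the propelinear group\<close>

lemma row_set_eq: "row_set H = row H ` {..<dim_row H}"
  by (auto simp: row_set_def rows_def)

lemma const_vec_carrier [simp]: "const_vec n a \<in> carrier_vec n"
  by (simp add: const_vec_def)

lemma index_const_vec [simp]: "i < n \<Longrightarrow> const_vec n a $ i = a"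
  by (simp add: const_vec_def)

lemma dim_const_vec [simp]: "dim_vec (const_vec n a) = n"
  by (simp add: const_vec_def)

lemma dim_permute_coords [simp]: "dim_vec (permute_coords p y) = dim_vec y"
  by (simp add: permute_coords_def)

lemma index_permute_coords [simp]:
  "i < dim_vec y \<Longrightarrow> permute_coords p y $ i = y $ inv_into UNIV p i"
  by (simp add: permute_coords_def)

lemma permute_coords_carrier: "y \<in> carrier_vec n \<Longrightarrow> permute_coords p y \<in> carrier_vec n"
  by (intro carrier_vecI) simp

lemma permute_coords_id [simp]: "permute_coords id y = y"
  by (rule eq_vecI) simp_all

lemma permutes_inv_less:
  assumes "p permutes {..<n}" "i < n"
  shows "inv_into UNIV p i < n"
  using permutes_in_image[OF permutes_inv[OF assms(1)], of i] assms(2)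
  unfolding lessThan_iff by blast

lemma permute_coords_const:
  "p permutes {..<n} \<Longrightarrow> permute_coords p (const_vec n a) = const_vec n a"
  by (rule eq_vecI) (simp_all add: permutes_inv_less)

lemma permute_coords_add:
  assumes "p permutes {..<n}" "x \<in> carrier_vec n" "y \<in> carrier_vec n"
  shows "permute_coords p (x + y) = permute_coords p x + permute_coords p y"
  using assms by (intro eq_vecI) (simp_all add: permutes_inv_less)

text \<open>The inverse in \<open>permute_coords\<close> makes it a left action, so the order of
  \<open>p\<close> and \<open>q\<close> is kept.\<close>

lemma permute_coords_comp:
  assumes p: "p permutes {..<n}" and q: "q permutes {..<n}" and y: "y \<in> carrier_vec n"
  shows "permute_coords (p \<circ> q) y = permute_coords p (permute_coords q y)"
proof (rule eq_vecI)
  fix i assume "i < dim_vec (permute_coords p (permute_coords q y))"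
  then have "i < n" using y by simp
  then show "permute_coords (p \<circ> q) y $ i = permute_coords p (permute_coords q y) $ i"
    using y permutes_inv_less[OF p, of i]
    by (simp add: o_inv_distrib[OF permutes_bij[OF p] permutes_bij[OF q]])
qed simp

text \<open>Associativity combines the multiplicativity of \<open>\<pi>\<close> with the additivity
  of permuting coordinates. Right inverses exist because left multiplication by \<open>x\<close>
  maps the code onto itself, so it attains the zero vector.\<close>

lemma group_propelinear_group:
  assumes "full_propelinear n C \<pi>"
  shows "group (propelinear_group n C \<pi>)"
proof -
  note fp = assms[unfolded full_propelinear_def]
  have car: "x \<in> carrier_vec n" if "x \<in> C" for x using fp that by blast
  have perm: "\<pi> x permutes {..<n}" if "x \<in> C" for x using fp that by blast
  have closed: "propelinear_mult \<pi> x y \<in> C" if "x \<in> C" "y \<in> C" for x y using fp that by blast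
  have comp: "\<pi> (propelinear_mult \<pi> x y) = \<pi> x \<circ> \<pi> y" if "x \<in> C" "y \<in> C" for x y
    using fp that by blast
  \<comment> \<open>Seen as a constant vector, zero has the trivial permutation and is fixed by
    every permutation.\<close>
  have zero: "0\<^sub>v n = const_vec n 0" by auto
  have "\<pi> (0\<^sub>v n) = id" using fp zero by blast
  then have left_one: "propelinear_mult \<pi> (0\<^sub>v n) x = x" if "x \<in> C" for x
    using car[OF that] by (simp add: propelinear_mult_def)
  have right_one: "propelinear_mult \<pi> x (0\<^sub>v n) = x" if "x \<in> C" for x
    using car[OF that] perm[OF that]
    by (simp add: propelinear_mult_def zero permute_coords_const) (simp flip: zero)
  have assoc: "propelinear_mult \<pi> (propelinear_mult \<pi> x y) z =
      propelinear_mult \<pi> x (propelinear_mult \<pi> y z)" if "x \<in> C" "y \<in> C" "z \<in> C" for x y z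
  proof -
    have "propelinear_mult \<pi> (propelinear_mult \<pi> x y) z =
        (x + permute_coords (\<pi> x) y) + permute_coords (\<pi> x \<circ> \<pi> y) z"
      by (simp add: propelinear_mult_def comp[OF that(1,2), unfolded propelinear_mult_def])
    also have "\<dots> = x + permute_coords (\<pi> x) (y + permute_coords (\<pi> y) z)"
      using that by (simp add: permute_coords_comp[where n = n] permute_coords_add[where n = n]
          permute_coords_carrier car perm assoc_add_vec[where n = n])
    finally show ?thesis by (simp add: propelinear_mult_def)
  qed
  interpret monoid "propelinear_group n C \<pi>"
    by unfold_locales
       (use fp in \<open>auto simp: propelinear_group_def closed assoc left_one right_one\<close>)
  have right_inv: "\<exists>y\<in>C. propelinear_mult \<pi> x y = 0\<^sub>v n" if "x \<in> C" for x
  proof -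
    have "0\<^sub>v n \<in> propelinear_mult \<pi> x ` C" using fp that by simp
    then show ?thesis by (metis imageE)
  qed
  have "\<exists>y\<in>C. propelinear_mult \<pi> y x = 0\<^sub>v n" if x: "x \<in> C" for x
  proof -
    obtain y where y: "y \<in> C" "propelinear_mult \<pi> x y = 0\<^sub>v n" using right_inv x by blast
    obtain z where z: "z \<in> C" "propelinear_mult \<pi> y z = 0\<^sub>v n" using right_inv y by blast
    \<comment> \<open>Bracketing the product of \<open>x\<close>, \<open>y\<close>, \<open>z\<close>
      in both ways identifies the right inverse \<open>z\<close> of \<open>y\<close> with
      \<open>x\<close>, so \<open>y\<close> is also a left inverse of \<open>x\<close>.\<close>
    have "x = z" using assoc[OF x y(1) z(1)] x z y by (simp add: left_one right_one)
    then show ?thesis using y z by blast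
  qed
  then show ?thesis
    by (intro group_l_invI) (simp add: propelinear_group_def)
qed

section \<open>Rows and codewords of a normalized matrix\<close>

lemma mem_gh_code_iff:
  "x \<in> gh_code H \<longleftrightarrow> (\<exists>r\<in>row_set H. \<exists>a. x = r + const_vec (dim_col H) a)"
  by (auto simp: gh_code_def)

context
  fixes H :: "'a::{finite,field} mat" and v :: nat
  assumes gh: "generalized_hadamard v H" and norm: "normalized_mat H"
begin

lemma H_carrier: "H \<in> carrier_mat v v" and v_pos: "v > 0"
  using gh by (auto simp: generalized_hadamard_def)

lemma row_set_carrier: "r \<in> row_set H \<Longrightarrow> r \<in> carrier_vec v"
  using H_carrier by (auto simp: row_set_eq)

lemma row_set_index_0: "r \<in> row_set H \<Longrightarrow> r $ 0 = 0"
  using H_carrier norm v_pos by (auto simp: row_set_eq normalized_mat_def)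

text \<open>Rows start with 0, so the first coordinate of a codeword is the constant by which its
  row was shifted.\<close>

lemma row_set_eq_first_coord_0: "row_set H = {x \<in> gh_code H. x $ 0 = 0}"
proof (intro equalityI subsetI)
  fix x assume x: "x \<in> row_set H"
  then have "x = x + const_vec (dim_col H) 0"
    using row_set_carrier[OF x] H_carrier by auto
  then show "x \<in> {x \<in> gh_code H. x $ 0 = 0}"
    using x row_set_index_0 by (auto simp: mem_gh_code_iff)
next
  fix x assume "x \<in> {x \<in> gh_code H. x $ 0 = 0}"
  then obtain r a where r: "r \<in> row_set H" "x = r + const_vec v a" "x $ 0 = 0"
    using H_carrier by (auto simp: mem_gh_code_iff)
  then have "a = 0"
    using row_set_index_0[OF r(1)] row_set_carrier[OF r(1)] v_pos by simp
  then have "x = r"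
    using r row_set_carrier[OF r(1)] by auto
  then show "x \<in> row_set H" using r by simp
qed

lemma card_row_set: "card (row_set H) = v"
  using generalized_hadamard_inj_on_row[OF gh] H_carrier by (simp add: row_set_eq card_image)

text \<open>The first coordinate of a codeword determines its shift and thereby its row, so the
  decomposition is unique.\<close>

lemma card_gh_code: "card (gh_code H) = v * CARD('a)"
proof -
  have "inj_on (\<lambda>(r, a). r + const_vec v a) (row_set H \<times> (UNIV :: 'a set))"
  proof (intro inj_onI, clarify)
    fix r s and a b :: 'a
    assume rs: "r \<in> row_set H" "s \<in> row_set H" and eq: "r + const_vec v a = s + const_vec v b"
    note car = rs[THEN row_set_carrier]
    have ix: "r $ i + a = s $ i + b" if "i < v" for i
      using arg_cong[OF eq, of "\<lambda>x. x $ i"] that car by simp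
    have "a = b" using ix[OF v_pos] rs by (simp add: row_set_index_0)
    moreover from this have "r = s" using ix car by (intro eq_vecI) auto
    ultimately show "r = s \<and> a = b" by simp
  qed
  moreover have "gh_code H = (\<lambda>(r, a). r + const_vec v a) ` (row_set H \<times> UNIV)"
    using H_carrier by (force simp: mem_gh_code_iff)
  ultimately show ?thesis
    by (simp add: card_image card_cartesian_product card_row_set)
qed

lemma const_vec_in_gh_code: "const_vec v a \<in> gh_code H"
proof -
  have "row H 0 = 0\<^sub>v v"
    using H_carrier norm v_pos by (auto simp: normalized_mat_def)
  then have "0\<^sub>v v \<in> row_set H"
    using H_carrier v_pos by (force simp: row_set_eq)
  moreover have "const_vec v a = 0\<^sub>v v + const_vec (dim_col H) a"
    using H_carrier by auto
  ultimately show ?thesis unfolding mem_gh_code_iff by blast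
qed

text \<open>Column 0 vanishes, so column \<open>k\<close> is its own difference with column 0 and
  column balance applies. Distinct indices give distinct rows, so counting indices counts
  rows.\<close>

lemma card_row_set_index:
  assumes "k < v" "k \<noteq> 0"
  shows "card {r \<in> row_set H. r $ k = a} = v div CARD('a)"
proof -
  have "{r \<in> row_set H. r $ k = a} = row H ` {i\<in>{..<v}. H $$ (i, k) - H $$ (i, 0) = a}"
    using H_carrier norm assms by (auto simp: row_set_eq normalized_mat_def)
  moreover have "inj_on (row H) {i\<in>{..<v}. H $$ (i, k) - H $$ (i, 0) = a}"
    by (rule inj_on_subset[OF generalized_hadamard_inj_on_row[OF gh]]) auto
  ultimately show ?thesis
    using generalized_hadamard_columns[OF gh] assms v_pos by (simp add: card_image)
qed

end

section \<open>The rows as a central relative difference set\<close>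

theorem proposition3p8:
  fixes H :: "'a::{finite,field} mat"
    and \<pi> :: "'a vec \<Rightarrow> nat \<Rightarrow> nat"
    and q v :: nat
  assumes "q = CARD('a)"
    and "generalized_hadamard v H"
    and "normalized_mat H"
    and "ghfp_code v H \<pi>"
  defines "G \<equiv> propelinear_group v (gh_code H) \<pi>"
    and "D1 \<equiv> {x \<in> gh_code H. x $ 0 = 0}"
    and "C1 \<equiv> range (const_vec v :: 'a \<Rightarrow> 'a vec)"
  shows "row_set H = D1 \<and>
         central_relative_difference_set G C1 D1 v q v (v div q) \<and>
         G\<lparr>carrier := C1\<rparr> \<cong> (additive_group :: 'a monoid)"
proof -
  note gh = assms(2) and norm = assms(3)
  note code = gh norm
  note v = v_pos[OF code]
  have fp: "full_propelinear v (gh_code H) \<pi>"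
    using assms(4) by (simp add: ghfp_code_def)
  note fp' = fp[unfolded full_propelinear_def]
  interpret group G
    unfolding G_def by (rule group_propelinear_group[OF fp])
  have carG: "carrier G = gh_code H" and mult: "x \<otimes>\<^bsub>G\<^esub> y = x + permute_coords (\<pi> x) y"
    and oneG: "\<one>\<^bsub>G\<^esub> = const_vec v 0" for x y
    by (auto simp: G_def propelinear_group_def propelinear_mult_def)
  have vec: "x \<in> carrier_vec v" if "x \<in> carrier G" for x
    using fp' that carG by blast
  have perm: "\<pi> x permutes {..<v}" if "x \<in> carrier G" for x
    using fp' that carG by blast
  have C1: "C1 \<subseteq> carrier G"
    using const_vec_in_gh_code[OF code] by (auto simp: C1_def carG)
  have const_mult: "const_vec v a \<otimes>\<^bsub>G\<^esub> x = const_vec v a + x" for a :: 'a and x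
  proof -
    have "\<pi> (const_vec v a) = id"
      using fp' const_vec_in_gh_code[OF code] by blast
    then show ?thesis by (simp add: mult)
  qed
  have mult_const: "x \<otimes>\<^bsub>G\<^esub> const_vec v a = x + const_vec v a"
    if "x \<in> carrier G" for a :: 'a and x
    using perm[OF that] by (simp add: mult permute_coords_const)
  have const_add: "const_vec v a \<otimes>\<^bsub>G\<^esub> const_vec v b = const_vec v (a + b)" for a b :: 'a
    unfolding const_mult by auto
  have central: "z \<otimes>\<^bsub>G\<^esub> x = x \<otimes>\<^bsub>G\<^esub> z" if "z \<in> C1" "x \<in> carrier G" for z x
    using that vec[OF that(2)] unfolding C1_def
    by (auto simp: const_mult mult_const intro: comm_add_vec[where n = v])
  have inv_const: "inv\<^bsub>G\<^esub> (const_vec v a) = const_vec v (- a)" for a :: 'a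
    by (rule inv_equality) (use C1 in \<open>auto simp: const_add oneG C1_def\<close>)
  have sub: "subgroup C1 G"
  proof (rule subgroupI)
    fix a b assume "a \<in> C1" "b \<in> C1"
    then show "inv\<^bsub>G\<^esub> a \<in> C1" "a \<otimes>\<^bsub>G\<^esub> b \<in> C1"
      by (auto simp: C1_def inv_const const_add)
  qed (use C1 in \<open>auto simp: C1_def\<close>)
  have normal: "C1 \<lhd> G"
    unfolding normal_inv_iff
  proof (intro conjI sub ballI)
    fix x h assume x: "x \<in> carrier G" and h: "h \<in> C1"
    then have "x \<otimes>\<^bsub>G\<^esub> h \<otimes>\<^bsub>G\<^esub> inv\<^bsub>G\<^esub> x = h"
      using C1 by (metis central inv_solve_right' m_closed subsetD)
    then show "x \<otimes>\<^bsub>G\<^esub> h \<otimes>\<^bsub>G\<^esub> inv\<^bsub>G\<^esub> x \<in> C1" using h by simp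
  qed
  have inj_const: "inj (const_vec v :: 'a \<Rightarrow> 'a vec)"
    by (rule injI) (metis index_const_vec v)
  have cardC1: "card C1 = q"
    by (simp add: C1_def card_image[OF inj_const] assms(1))
  have D1: "row_set H = D1"
    unfolding D1_def by (rule row_set_eq_first_coord_0[OF code])
  have D1_car: "D1 \<subseteq> carrier G" by (auto simp: D1_def carG)
  have cardD1: "card D1 = v"
    using card_row_set[OF code] D1 by simp
  have finD1: "finite D1" using cardD1 v by (metis card.infinite less_irrefl)
  have orderG: "order G = v * q"
    using card_gh_code[OF code] by (simp add: order_def carG assms(1))
  \<comment> \<open>An infinite carrier would have order 0, whereas \<open>v * q\<close> is
    positive.\<close>
  have "finite (carrier G)"
    using orderG v assms(1) card_field_ge_2[where 'a = 'a] unfolding order_def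
    by (metis card.infinite mult_eq_0_iff not_numeral_le_zero order_less_irrefl)
  define P where "P = {(r1, r2). r1 \<in> D1 \<and> r2 \<in> D1 \<and> r1 \<noteq> r2}"
  define Q where "Q = image_mset (\<lambda>(r1, r2). r1 \<otimes>\<^bsub>G\<^esub> inv\<^bsub>G\<^esub> r2) (mset_set P)"
  have finP: "finite P"
    by (rule finite_subset[of _ "D1 \<times> D1"]) (use finD1 in \<open>auto simp: P_def\<close>)
  have quot: "r1 \<otimes>\<^bsub>G\<^esub> inv\<^bsub>G\<^esub> r2 = e \<longleftrightarrow> r1 = e \<otimes>\<^bsub>G\<^esub> r2"
    if "r1 \<in> carrier G" "r2 \<in> carrier G" "e \<in> carrier G" for r1 r2 e
    using that by (metis inv_solve_right')
  have countQ: "count Q e = v div q" if e: "e \<in> carrier G - C1" for e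
  proof -
    have eG: "e \<in> carrier G" and eC: "e \<notin> C1" using e by auto
    \<comment> \<open>This is the coordinate that \<open>\<pi> e\<close> moves to the first place.
      It differs from 0 because \<open>e\<close> is not constant, so its permutation fixes no
      coordinate.\<close>
    define k where "k = inv_into UNIV (\<pi> e) 0"
    have k: "k < v" unfolding k_def using permutes_inv_less[OF perm[OF eG] v] .
    have "\<pi> e k = 0" unfolding k_def using permutes_inverses(1)[OF perm[OF eG]] .
    moreover have "\<pi> e 0 \<noteq> 0" using fp' eG eC v unfolding C1_def carG by blast
    ultimately have k0: "k \<noteq> 0" by metis
    \<comment> \<open>This makes the condition \<open>r1 \<noteq> r2\<close> in \<open>P\<close>
      automatic for pairs with quotient \<open>e\<close>.\<close>
    have ne: "e \<otimes>\<^bsub>G\<^esub> r \<noteq> r" if "r \<in> carrier G" for r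
    proof
      assume "e \<otimes>\<^bsub>G\<^esub> r = r"
      then have "e = \<one>\<^bsub>G\<^esub>" using that eG by (simp add: l_cancel_one')
      then show False using eC oneG by (simp add: C1_def)
    qed
    have mem: "e \<otimes>\<^bsub>G\<^esub> r \<in> D1 \<longleftrightarrow> r $ k = - (e $ 0)" if "r \<in> D1" for r
    proof -
      have rG: "r \<in> carrier G" using that D1_car by blast
      have "(e \<otimes>\<^bsub>G\<^esub> r) $ 0 = e $ 0 + r $ k"
        using vec[OF rG] vec[OF eG] v by (simp add: mult permute_coords_def k_def)
      moreover have "e \<otimes>\<^bsub>G\<^esub> r \<in> gh_code H" using m_closed[OF eG rG] carG by simp
      ultimately show ?thesis by (simp add: D1_def eq_neg_iff_add_eq_0 add.commute)
    qed
    \<comment> \<open>A pair with quotient \<open>e\<close> is determined by its second entry, and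
      what remains is that both \<open>r2\<close> and its product with \<open>e\<close> are rows.
      Counting quotients thus becomes counting the value \<open>- (e $ 0)\<close> in column
      \<open>k\<close>.\<close>
    have "(r1, r2) \<in> {p\<in>P. (case p of (r1, r2) \<Rightarrow> r1 \<otimes>\<^bsub>G\<^esub> inv\<^bsub>G\<^esub> r2) = e} \<longleftrightarrow>
        (r1, r2) \<in> (\<lambda>r. (e \<otimes>\<^bsub>G\<^esub> r, r)) ` {r\<in>D1. r $ k = - (e $ 0)}" for r1 r2
    proof -
      have "(r1, r2) \<in> {p\<in>P. (case p of (r1, r2) \<Rightarrow> r1 \<otimes>\<^bsub>G\<^esub> inv\<^bsub>G\<^esub> r2) = e} \<longleftrightarrow>
          r1 \<in> D1 \<and> r2 \<in> D1 \<and> r1 \<noteq> r2 \<and> r1 \<otimes>\<^bsub>G\<^esub> inv\<^bsub>G\<^esub> r2 = e"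
        by (simp add: P_def)
      also have "\<dots> \<longleftrightarrow> r2 \<in> D1 \<and> r2 $ k = - (e $ 0) \<and> r1 = e \<otimes>\<^bsub>G\<^esub> r2"
        using quot[OF _ _ eG] ne mem D1_car by (metis subsetD)
      also have "\<dots> \<longleftrightarrow> (r1, r2) \<in> (\<lambda>r. (e \<otimes>\<^bsub>G\<^esub> r, r)) ` {r\<in>D1. r $ k = - (e $ 0)}"
        by blast
      finally show ?thesis .
    qed
    then have "{p\<in>P. (case p of (r1, r2) \<Rightarrow> r1 \<otimes>\<^bsub>G\<^esub> inv\<^bsub>G\<^esub> r2) = e} =
        (\<lambda>r. (e \<otimes>\<^bsub>G\<^esub> r, r)) ` {r\<in>D1. r $ k = - (e $ 0)}"
      by (simp only: set_eq_iff split_paired_All simp_thms)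
    then have "count Q e = card ((\<lambda>r. (e \<otimes>\<^bsub>G\<^esub> r, r)) ` {r\<in>D1. r $ k = - (e $ 0)})"
      by (simp only: Q_def count_image_mset_set[OF finP])
    also have "\<dots> = card {r\<in>D1. r $ k = - (e $ 0)}"
      by (rule card_image) (auto intro: inj_onI)
    finally show ?thesis
      using card_row_set_index[OF code k k0] by (simp add: D1 assms(1))
  qed
  have forbidden: "z \<notin># Q" if z: "z \<in> C1" for z
  proof
    assume "z \<in># Q"
    then obtain r1 r2 where r: "r1 \<in> D1" "r2 \<in> D1" "r1 \<noteq> r2" "r1 \<otimes>\<^bsub>G\<^esub> inv\<^bsub>G\<^esub> r2 = z"
      using finP by (auto simp: Q_def P_def)
    obtain a where a: "z = const_vec v a" using z by (auto simp: C1_def)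
    have r2: "r2 \<in> carrier_vec v" using r D1_car vec by blast
    have "r1 = z \<otimes>\<^bsub>G\<^esub> r2"
      using r quot[of r1 r2 z] D1_car C1 z by blast
    then have "r1 = const_vec v a + r2"
      by (simp only: a const_mult)
    \<comment> \<open>Both \<open>r1\<close> and \<open>r2\<close> have first coordinate 0, so
      comparing first coordinates leaves \<open>a\<close> alone.\<close>
    moreover from this have "a = 0" using r r2 v by (simp add: D1_def)
    ultimately have "r1 = r2" using r2 by auto
    then show False using r by simp
  qed
  have "relative_difference_set G C1 D1 v q v (v div q)"
    unfolding relative_difference_set_def Let_def
    using is_group \<open>finite (carrier G)\<close> orderG normal cardC1 D1_car cardD1 countQ forbidden
    unfolding Q_def P_def by blast
  then have rds: "central_relative_difference_set G C1 D1 v q v (v div q)"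
    using central unfolding central_relative_difference_set_def by blast
  \<comment> \<open>On constants, reading the first coordinate is inverse to
    \<open>const_vec v\<close>; this needs \<open>v\<close> to be positive.\<close>
  have "(\<lambda>x. x $ 0) \<in> iso (G\<lparr>carrier := C1\<rparr>) (additive_group :: 'a monoid)"
  proof (rule isoI)
    show "(\<lambda>x. x $ 0) \<in> hom (G\<lparr>carrier := C1\<rparr>) (additive_group :: 'a monoid)"
      using v by (auto simp: hom_def additive_group_def C1_def const_add)
    show "bij_betw (\<lambda>x. x $ 0) (carrier (G\<lparr>carrier := C1\<rparr>))
        (carrier (additive_group :: 'a monoid))"
      by (rule bij_betwI[where g = "const_vec v"])
         (use v in \<open>auto simp: additive_group_def C1_def\<close>)
  qed
  then show ?thesis
    using D1 rds by (auto simp: is_iso_def)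
qed

end
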